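(* The following four identities hold in the ring of formal power series in the variables $x_1,x_2,x_3,\ldots$ (empty products equal $1$): $$\sum_{\lambda\in\mathcal{G}_1}x^{\lambda}=1+\sum_{n=1}^{\infty}\frac{X_1^{2}X_2^{2}\cdots X_n^2\,\Big(\prod_{i=1}^{n-1}(1+X_{i-1}X_i)\Big)\,(1+X_{n-1}/X_n)}{(1-X_1^2)(1-X_2^2)\cdots(1-X_n^2)},$$ $$\sum_{\lambda\in\mathcal{G}_2}x^{\lambda}=1+\sum_{n=1}^{\infty}\frac{X_1^2X_2^2\cdots X_{n}^{2}\,\prod_{i=1}^{n}(1+X_{i-1}X_i)}{(1-X_1^2)(1-X_2^2)\cdots(1-X_n^2)},$$ $$\sum_{\lambda\in\mathcal{G}_{1}'}x^{\lambda}=1+\sum_{n=1}^{\infty}\frac{X_1X_2\cdots X_{2n-1}\,\prod_{i=1}^{n}(1+X_{2i-2}X_{2i-1})}{(1-X_1^{2})(1-X_2^2)\cdots(1-X_{2n}^{2})},$$ $$\sum_{\lambda\in\mathcal{G}_{2}'}x^{\lambda}=1+\sum_{n=1}^{\infty}\frac{X_1X_2\cdots X_{2n}\,\Big(\prod_{i=1}^{n-1}(1+X_{2i-1}X_{2i})\Big)\,(1+X_{2n-1}/X_{2n})}{(1-X_1^{2})(1-X_2^{2})\cdots(1-X_{2n}^{2})}.$$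
   Context: A partition is a finite weakly decreasing sequence of positive integers $\lambda=(\lambda_1,\ldots,\lambda_\ell)$ (the empty partition, $\ell=0$, is included); $\ell=\ell(\lambda)$ is its length. It is strict if the sequence is strictly decreasing. The odd-indexed parts are $\lambda_1,\lambda_3,\lambda_5,\ldots$ and the even-indexed parts are $\lambda_2,\lambda_4,\lambda_6,\ldots$. $\mathcal{G}_1$ is the set of partitions such that for all $1\le i<\ell(\lambda)$, $\lambda_i-\lambda_{i+1}\geq 2$, and $\lambda_i-\lambda_{i+1}\geq 3$ if $\lambda_i$ is odd. $\mathcal{G}_2$ is the set of partitions in $\mathcal{G}_1$ all of whose parts are at least $2$. $\mathcal{G}_1'$ is the set of strict partitions whose even-indexed parts are all even. $\mathcal{G}_2'$ is the set of strict partitions whose odd-indexed parts are all even. The empty partition belongs to all four sets. For commuting variables $x_1,x_2,\ldots$ put $x^{\lambda}:=x_1^{\lambda_1}x_2^{\lambda_2}\cdots x_\ell^{\lambda_\ell}$ (with $x^{\emptyset}=1$), $X_i:=x_1x_2\cdots x_i$ for $i\ge1$, and $X_i:=1$ for $i\leq 0$. Quotients such as $X_{n-1}/X_n$ always occur multiplied by monomials that clear the denominator, so every summand is a formal power series. *)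

theory Defs
  imports
    "HOL-Analysis.Infinite_Sum"
    "HOL-Library.Poly_Mapping"
    "HOL-Computational_Algebra.Polynomial_Factorial"
begin

section \<open>Formal power series in countably many variables\<close>

text \<open>
  A series is an arbitrary family of coefficients indexed by the monomials, and a monomial is a
  finitely supported exponent vector \<^typ>\<open>nat \<Rightarrow>\<^sub>0 nat\<close>.  The variables are indexed from 0: the
  variable written $x_{j+1}$ on paper has index \<^term>\<open>j\<close>, so that there are exactly
  the variables $x_1, x_2, \ldots$
\<close>

typedef 'a mfps = "UNIV :: ((nat \<Rightarrow>\<^sub>0 nat) \<Rightarrow> 'a) set"
  morphisms mcoeff Abs_mfps ..

lemma mcoeff_Abs [simp]: "mcoeff (Abs_mfps f) m = f m"
  by (simp add: Abs_mfps_inverse)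

lemma mfps_eqI: "(\<And>m. mcoeff f m = mcoeff g m) \<Longrightarrow> f = g"
  by (metis ext mcoeff_inject)

definition splits :: "(nat \<Rightarrow>\<^sub>0 nat) \<Rightarrow> ((nat \<Rightarrow>\<^sub>0 nat) \<times> (nat \<Rightarrow>\<^sub>0 nat)) set" where
  "splits m = {(a, b). a + b = m}"

lemma finite_splits [simp]: "finite (splits m)"
proof -
  let ?S = "PiE (Poly_Mapping.keys m) (\<lambda>k. {..poly_mapping.lookup m k})"
  have fin: "finite ?S" by (intro finite_PiE) auto
  let ?h = "\<lambda>p :: (nat \<Rightarrow>\<^sub>0 nat) \<times> (nat \<Rightarrow>\<^sub>0 nat). restrict (poly_mapping.lookup (fst p)) (Poly_Mapping.keys m)"
  have "?h ` splits m \<subseteq> ?S"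
    by (auto simp: splits_def lookup_add)
  moreover have "inj_on ?h (splits m)"
  proof (rule inj_onI)
    fix p q assume p: "p \<in> splits m" and q: "q \<in> splits m" and e: "?h p = ?h q"
    have s: "fst p + snd p = m" "fst q + snd q = m"
      using p q by (auto simp: splits_def)
    have "poly_mapping.lookup (fst p) k = poly_mapping.lookup (fst q) k" for k
    proof (cases "k \<in> Poly_Mapping.keys m")
      case True
      then show ?thesis using fun_cong[OF e, of k] by simp
    next
      case False
      then have "poly_mapping.lookup (fst p) k + poly_mapping.lookup (snd p) k = 0" "poly_mapping.lookup (fst q) k + poly_mapping.lookup (snd q) k = 0"
        using s by (metis in_keys_iff lookup_add)+
      then show ?thesis by simp
    qed
    then have "fst p = fst q" by (intro poly_mapping_eqI)
    then show "p = q" using s by (metis add_left_cancel prod.expand)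
  qed
  ultimately show ?thesis using fin by (meson finite_imageD finite_subset)
qed

instantiation mfps :: (comm_ring_1) comm_ring_1
begin

definition "0 = Abs_mfps (\<lambda>m. 0)"
definition "1 = Abs_mfps (\<lambda>m. if m = 0 then 1 else 0)"
definition "f + g = Abs_mfps (\<lambda>m. mcoeff f m + mcoeff g m)"
definition "f - g = Abs_mfps (\<lambda>m. mcoeff f m - mcoeff g m)"
definition "- f = Abs_mfps (\<lambda>m. - mcoeff f m)"
definition "f * g = Abs_mfps (\<lambda>m. \<Sum>(a, b)\<in>splits m. mcoeff f a * mcoeff g b)"

instance
proof
  fix f g h :: "'a mfps"
  show "f + g + h = f + (g + h)" "f + g = g + f" "0 + f = f" "- f + f = 0" "f - g = f + - g"
    by (auto intro!: mfps_eqI simp: plus_mfps_def minus_mfps_def uminus_mfps_def zero_mfps_def)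
  show "(f + g) * h = f * h + g * h"
    by (auto intro!: mfps_eqI
        simp: plus_mfps_def times_mfps_def ring_distribs sum.distrib case_prod_unfold)
  show "f * g = g * f"
  proof (rule mfps_eqI)
    fix m
    have "(\<Sum>(a, b)\<in>splits m. mcoeff f a * mcoeff g b) =
          (\<Sum>(a, b)\<in>splits m. mcoeff g a * mcoeff f b)"
      by (rule sum.reindex_bij_witness[of _ prod.swap prod.swap])
         (auto simp: splits_def ac_simps)
    then show "mcoeff (f * g) m = mcoeff (g * f) m" by (simp add: times_mfps_def)
  qed
  show "1 * f = f"
  proof (rule mfps_eqI)
    fix m
    have "(\<Sum>(a, b)\<in>splits m. mcoeff 1 a * mcoeff f b) =
          (\<Sum>(a, b)\<in>{(0, m)}. mcoeff 1 a * mcoeff f b)"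
      by (rule sum.mono_neutral_right[OF finite_splits])
         (auto simp: splits_def one_mfps_def split: if_splits)
    then show "mcoeff (1 * f) m = mcoeff f m" by (simp add: times_mfps_def one_mfps_def)
  qed
  show "(0 :: 'a mfps) \<noteq> 1"
  proof
    assume "(0 :: 'a mfps) = 1"
    then have "mcoeff (0 :: 'a mfps) 0 = mcoeff 1 0" by simp
    then show False by (simp add: zero_mfps_def one_mfps_def)
  qed
  show "f * g * h = f * (g * h)"
  proof (rule mfps_eqI)
    fix m
    have "mcoeff (f * g * h) m =
        (\<Sum>p\<in>splits m. \<Sum>q\<in>splits (fst p). mcoeff f (fst q) * mcoeff g (snd q) * mcoeff h (snd p))"
      by (simp add: times_mfps_def case_prod_unfold sum_distrib_right)
    also have "\<dots> = (\<Sum>(p, q)\<in>(SIGMA p:splits m. splits (fst p)).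
          mcoeff f (fst q) * mcoeff g (snd q) * mcoeff h (snd p))"
      by (rule sum.Sigma) auto
    also have "\<dots> = (\<Sum>(p, q)\<in>(SIGMA p:splits m. splits (snd p)).
          mcoeff f (fst p) * (mcoeff g (fst q) * mcoeff h (snd q)))"
      by (rule sum.reindex_bij_witness[of _
            "\<lambda>(p, q). ((fst p + fst q, snd q), (fst p, fst q))"
            "\<lambda>(p, q). ((fst q, snd q + snd p), (snd q, snd p))"])
         (auto simp: splits_def add.assoc mult.assoc)
    also have "\<dots> = (\<Sum>p\<in>splits m. \<Sum>q\<in>splits (snd p).
          mcoeff f (fst p) * (mcoeff g (fst q) * mcoeff h (snd q)))"
      by (rule sum.Sigma[symmetric]) auto
    also have "\<dots> = mcoeff (f * (g * h)) m"
      by (simp add: times_mfps_def case_prod_unfold sum_distrib_left)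
    finally show "mcoeff (f * g * h) m = mcoeff (f * (g * h)) m" .
  qed
qed

end

lemma mcoeff_0 [simp]: "mcoeff 0 m = 0"
  and mcoeff_1: "mcoeff 1 m = (if m = 0 then 1 else 0)"
  and mcoeff_add [simp]: "mcoeff (f + g) m = mcoeff f m + mcoeff g m"
  and mcoeff_diff [simp]: "mcoeff (f - g) m = mcoeff f m - mcoeff g m"
  and mcoeff_uminus [simp]: "mcoeff (- f) m = - mcoeff f m"
  and mcoeff_mult: "mcoeff (f * g) m = (\<Sum>(a, b)\<in>splits m. mcoeff f a * mcoeff g b)"
  by (simp_all add: zero_mfps_def one_mfps_def plus_mfps_def minus_mfps_def
      uminus_mfps_def times_mfps_def)

lemma mcoeff_sum [simp]: "mcoeff (sum f A) m = (\<Sum>i\<in>A. mcoeff (f i) m)"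
  by (induction A rule: infinite_finite_induct) auto

text \<open>
  To see that there are no zero divisors, pick $N$ such that both factors have a nonzero
  coefficient at a monomial in the first $N$ variables only; among those monomials, compare the
  ones of least degree lexicographically.
\<close>

lemma mfps_least_monomial:
  fixes f :: "'a::comm_ring_1 mfps"
  assumes "mcoeff f a' \<noteq> 0" "Poly_Mapping.keys a' \<subseteq> {..<N}"
  obtains a where "mcoeff f a \<noteq> 0" "Poly_Mapping.keys a \<subseteq> {..<N}"
    "\<And>b. mcoeff f b \<noteq> 0 \<Longrightarrow> Poly_Mapping.keys b \<subseteq> {..<N} \<Longrightarrow> (\<Sum>i<N. poly_mapping.lookup a i) \<le> (\<Sum>i<N. poly_mapping.lookup b i)"
    "\<And>b. mcoeff f b \<noteq> 0 \<Longrightarrow> Poly_Mapping.keys b \<subseteq> {..<N} \<Longrightarrow> (\<Sum>i<N. poly_mapping.lookup a i) = (\<Sum>i<N. poly_mapping.lookup b i) \<Longrightarrow> a \<le> b"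
proof -
  let ?deg = "\<lambda>a :: nat \<Rightarrow>\<^sub>0 nat. \<Sum>i<N. poly_mapping.lookup a i"
  let ?P = "\<lambda>a. mcoeff f a \<noteq> 0 \<and> Poly_Mapping.keys a \<subseteq> {..<N}"
  obtain a0 where a0: "?P a0" and min: "\<And>b. ?P b \<Longrightarrow> ?deg a0 \<le> ?deg b"
    using ex_has_least_nat[of ?P a' ?deg] assms by blast
  let ?A = "{a. ?P a \<and> ?deg a = ?deg a0}"
  let ?h = "\<lambda>a :: nat \<Rightarrow>\<^sub>0 nat. restrict (poly_mapping.lookup a) {..<N}"
  have "?h ` ?A \<subseteq> PiE {..<N} (\<lambda>_. {..?deg a0})"
  proof (clarsimp)
    fix a i assume "?deg a = ?deg a0" "i < N"
    then show "poly_mapping.lookup a i \<le> ?deg a0"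
      by (metis finite_lessThan lessThan_iff member_le_sum zero_le)
  qed
  moreover have "inj_on ?h ?A"
  proof (rule inj_onI, rule poly_mapping_eqI)
    fix a b k assume a: "a \<in> ?A" and b: "b \<in> ?A" and e: "?h a = ?h b"
    show "poly_mapping.lookup a k = poly_mapping.lookup b k"
    proof (cases "k < N")
      case True
      then show ?thesis using fun_cong[OF e, of k] by simp
    next
      case False
      then have "k \<notin> Poly_Mapping.keys a" "k \<notin> Poly_Mapping.keys b" using a b by auto
      then show ?thesis by (simp add: in_keys_iff)
    qed
  qed
  ultimately have fin: "finite ?A"
    by (meson finite_PiE finite_atMost finite_imageD finite_lessThan finite_subset)
  have "Min ?A \<in> ?A" using fin a0 by (intro Min_in) auto
  moreover have "Min ?A \<le> b" if "?P b" "?deg a0 = ?deg b" for b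
    using fin that by (intro Min_le) auto
  ultimately show ?thesis using min by (intro that[of "Min ?A"]) auto
qed

instance mfps :: (idom) idom
proof
  fix f g :: "'a mfps"
  assume "f \<noteq> 0" "g \<noteq> 0"
  then obtain a' b' where ab': "mcoeff f a' \<noteq> 0" "mcoeff g b' \<noteq> 0"
    by (metis mcoeff_0 mfps_eqI)
  have "finite (Poly_Mapping.keys a' \<union> Poly_Mapping.keys b')" by simp
  then obtain N where "Poly_Mapping.keys a' \<union> Poly_Mapping.keys b' \<subseteq> {..<N}"
    unfolding finite_nat_iff_bounded by blast
  then have N: "Poly_Mapping.keys a' \<subseteq> {..<N}" "Poly_Mapping.keys b' \<subseteq> {..<N}" by simp_all
  let ?deg = "\<lambda>a :: nat \<Rightarrow>\<^sub>0 nat. \<Sum>i<N. poly_mapping.lookup a i"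
  obtain a where a: "mcoeff f a \<noteq> 0" "Poly_Mapping.keys a \<subseteq> {..<N}"
      "\<And>b. mcoeff f b \<noteq> 0 \<Longrightarrow> Poly_Mapping.keys b \<subseteq> {..<N} \<Longrightarrow> ?deg a \<le> ?deg b"
      "\<And>b. mcoeff f b \<noteq> 0 \<Longrightarrow> Poly_Mapping.keys b \<subseteq> {..<N} \<Longrightarrow> ?deg a = ?deg b \<Longrightarrow> a \<le> b"
    by (rule mfps_least_monomial[OF ab'(1) N(1)]) blast
  obtain b where b: "mcoeff g b \<noteq> 0" "Poly_Mapping.keys b \<subseteq> {..<N}"
      "\<And>c. mcoeff g c \<noteq> 0 \<Longrightarrow> Poly_Mapping.keys c \<subseteq> {..<N} \<Longrightarrow> ?deg b \<le> ?deg c"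
      "\<And>c. mcoeff g c \<noteq> 0 \<Longrightarrow> Poly_Mapping.keys c \<subseteq> {..<N} \<Longrightarrow> ?deg b = ?deg c \<Longrightarrow> b \<le> c"
    by (rule mfps_least_monomial[OF ab'(2) N(2)]) blast
  have uniq: "c = a \<and> d = b"
    if cd: "c + d = a + b" and nz: "mcoeff f c \<noteq> 0" "mcoeff g d \<noteq> 0" for c d
  proof -
    have "Poly_Mapping.keys c \<union> Poly_Mapping.keys d \<subseteq> Poly_Mapping.keys a \<union> Poly_Mapping.keys b"
    proof
      fix k assume "k \<in> Poly_Mapping.keys c \<union> Poly_Mapping.keys d"
      then have "poly_mapping.lookup (c + d) k \<noteq> 0" by (auto simp: lookup_add in_keys_iff)
      then show "k \<in> Poly_Mapping.keys a \<union> Poly_Mapping.keys b" unfolding cd by (auto simp: lookup_add in_keys_iff)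
    qed
    then have k: "Poly_Mapping.keys c \<subseteq> {..<N}" "Poly_Mapping.keys d \<subseteq> {..<N}" using a(2) b(2) by auto
    have "?deg c + ?deg d = ?deg a + ?deg b"
      using arg_cong[OF cd, of ?deg] by (simp add: lookup_add sum.distrib)
    moreover have "?deg a \<le> ?deg c" "?deg b \<le> ?deg d"
      using a(3) b(3) nz k by auto
    ultimately have "?deg a = ?deg c" "?deg b = ?deg d" by linarith+
    then have le: "a \<le> c" "b \<le> d" using a(4) b(4) nz k by auto
    have "a + b \<le> a + d" "a + d \<le> c + d"
      by (rule add_left_mono[OF le(2)] add_right_mono[OF le(1)])+
    then have "a + d = c + d" using cd by simp
    then have "c = a" by simp
    then show ?thesis using cd by simp
  qed
  have "mcoeff (f * g) (a + b) = (\<Sum>(c, d)\<in>{(a, b)}. mcoeff f c * mcoeff g d)"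
    unfolding mcoeff_mult
    by (rule sum.mono_neutral_right[OF finite_splits]) (use uniq in \<open>force simp: splits_def\<close>)+
  then have "mcoeff (f * g) (a + b) \<noteq> 0" using a(1) b(1) by simp
  then show "f * g \<noteq> 0" by auto
qed

text \<open>
  The usual topology: coefficientwise convergence over a discrete coefficient ring.  The lemma
  \<open>has_sum_mfps_iff\<close> below spells out what convergence of an infinite sum of series means.
\<close>

instantiation mfps :: (type) t2_space
begin

definition "open (U :: 'a mfps set) \<longleftrightarrow>
  (\<forall>f\<in>U. \<exists>M. finite M \<and> (\<forall>g. (\<forall>m\<in>M. mcoeff g m = mcoeff f m) \<longrightarrow> g \<in> U))"

instance
proof
  show "open (UNIV :: 'a mfps set)" unfolding open_mfps_def by (intro ballI exI[of _ "{}"]) simp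
next
  fix S T :: "'a mfps set" assume ST: "open S" "open T"
  show "open (S \<inter> T)" unfolding open_mfps_def
  proof
    fix f assume "f \<in> S \<inter> T"
    then have "f \<in> S" "f \<in> T" by simp_all
    obtain M where M: "finite M" "\<forall>g. (\<forall>m\<in>M. mcoeff g m = mcoeff f m) \<longrightarrow> g \<in> S"
      using bspec[OF ST(1)[unfolded open_mfps_def] \<open>f \<in> S\<close>] by (elim exE conjE)
    obtain M' where M': "finite M'" "\<forall>g. (\<forall>m\<in>M'. mcoeff g m = mcoeff f m) \<longrightarrow> g \<in> T"
      using bspec[OF ST(2)[unfolded open_mfps_def] \<open>f \<in> T\<close>] by (elim exE conjE)
    from M M'
    show "\<exists>M. finite M \<and> (\<forall>g. (\<forall>m\<in>M. mcoeff g m = mcoeff f m) \<longrightarrow> g \<in> S \<inter> T)"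
      by (intro exI[of _ "M \<union> M'"]) simp
  qed
next
  fix K :: "'a mfps set set" assume K: "\<forall>S\<in>K. open S"
  show "open (\<Union> K)" unfolding open_mfps_def
  proof
    fix f assume "f \<in> \<Union> K"
    then obtain S where S: "S \<in> K" "f \<in> S" by blast
    have "open S" using K S(1) by (rule bspec)
    obtain M where M: "finite M" "\<forall>g. (\<forall>m\<in>M. mcoeff g m = mcoeff f m) \<longrightarrow> g \<in> S"
      using bspec[OF \<open>open S\<close>[unfolded open_mfps_def] S(2)] by (elim exE conjE)
    show "\<exists>M. finite M \<and> (\<forall>g. (\<forall>m\<in>M. mcoeff g m = mcoeff f m) \<longrightarrow> g \<in> \<Union> K)"
      using M S(1) by (intro exI[of _ M]) auto
  qed
next
  fix f g :: "'a mfps" assume "f \<noteq> g"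
  then obtain m where m: "mcoeff f m \<noteq> mcoeff g m" by (metis mfps_eqI)
  have op: "open {h :: 'a mfps. mcoeff h m = c}" for c
    unfolding open_mfps_def by (auto intro!: exI[of _ "{m}"])
  let ?U = "\<lambda>c. {h :: 'a mfps. mcoeff h m = c}"
  have "?U (mcoeff f m) \<inter> ?U (mcoeff g m) = {}" using m by auto
  then show "\<exists>U V. open U \<and> open V \<and> f \<in> U \<and> g \<in> V \<and> U \<inter> V = {}"
    by - (rule exI[of _ "?U (mcoeff f m)"], rule exI[of _ "?U (mcoeff g m)"], simp add: op)
qed

end

lemma has_sum_mfps_iff:
  fixes F :: "'i \<Rightarrow> 'a::comm_ring_1 mfps"
  shows "(F has_sum s) I \<longleftrightarrow>
    (\<forall>m. finite {i\<in>I. mcoeff (F i) m \<noteq> 0} \<and>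
         mcoeff s m = (\<Sum>i | i \<in> I \<and> mcoeff (F i) m \<noteq> 0. mcoeff (F i) m))"
proof (intro iffI allI)
  fix m assume s: "(F has_sum s) I"
  have "open {h :: 'a mfps. mcoeff h m = mcoeff s m}"
    unfolding open_mfps_def by (auto intro!: exI[of _ "{m}"])
  then have "\<forall>\<^sub>F J in finite_subsets_at_top I. sum F J \<in> {h. mcoeff h m = mcoeff s m}"
    using s unfolding has_sum_def by (intro topological_tendstoD) auto
  then obtain J where J: "finite J" "J \<subseteq> I"
      and *: "\<And>Y. finite Y \<Longrightarrow> J \<subseteq> Y \<Longrightarrow> Y \<subseteq> I \<Longrightarrow> mcoeff (sum F Y) m = mcoeff s m"
    unfolding eventually_finite_subsets_at_top by auto
  have sub: "{i\<in>I. mcoeff (F i) m \<noteq> 0} \<subseteq> J"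
  proof (rule ccontr)
    assume "\<not> ?thesis"
    then obtain i where i: "i \<in> I" "mcoeff (F i) m \<noteq> 0" "i \<notin> J" by auto
    have "mcoeff (sum F (insert i J)) m = mcoeff s m" "mcoeff (sum F J) m = mcoeff s m"
      using *[of "insert i J"] *[of J] i J by blast+
    then show False using i J by simp
  qed
  have "mcoeff s m = (\<Sum>i\<in>J. mcoeff (F i) m)" using *[of J] J by simp
  also have "\<dots> = (\<Sum>i | i \<in> I \<and> mcoeff (F i) m \<noteq> 0. mcoeff (F i) m)"
    using J sub by (intro sum.mono_neutral_right) auto
  finally show "finite {i\<in>I. mcoeff (F i) m \<noteq> 0} \<and>
      mcoeff s m = (\<Sum>i | i \<in> I \<and> mcoeff (F i) m \<noteq> 0. mcoeff (F i) m)"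
    using sub J finite_subset by blast
next
  let ?A = "\<lambda>m. {i\<in>I. mcoeff (F i) m \<noteq> 0}"
  assume *: "\<forall>m. finite (?A m) \<and> mcoeff s m = (\<Sum>i\<in>?A m. mcoeff (F i) m)"
  show "(F has_sum s) I"
    unfolding has_sum_def
  proof (rule topological_tendstoI)
    fix U assume "open U" "s \<in> U"
    then obtain M where M: "finite M" "\<And>g. (\<forall>m\<in>M. mcoeff g m = mcoeff s m) \<Longrightarrow> g \<in> U"
      unfolding open_mfps_def by metis
    show "\<forall>\<^sub>F J in finite_subsets_at_top I. sum F J \<in> U"
      unfolding eventually_finite_subsets_at_top
    proof (intro exI[of _ "\<Union>m\<in>M. ?A m"] conjI allI impI)
      show "finite (\<Union>m\<in>M. ?A m)" using * M(1) by blast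
      fix Y assume Y: "finite Y \<and> (\<Union>m\<in>M. ?A m) \<subseteq> Y \<and> Y \<subseteq> I"
      have "mcoeff (sum F Y) m = mcoeff s m" if "m \<in> M" for m
      proof -
        have "(\<Sum>i\<in>Y. mcoeff (F i) m) = (\<Sum>i\<in>?A m. mcoeff (F i) m)"
          using Y that by (intro sum.mono_neutral_right) auto
        then show ?thesis using * by simp
      qed
      then show "sum F Y \<in> U" using M(2) by blast
    qed auto
  qed
qed

definition mfps_var :: "nat \<Rightarrow> 'a::comm_ring_1 mfps" where
  "mfps_var j = Abs_mfps (\<lambda>m. if m = Poly_Mapping.single j 1 then 1 else 0)"

text \<open>
  The quotients below, such as $X_{n-1}/X_n$, live in the field of fractions.  The next definition
  says that each \<open>Q i\<close> is nevertheless a power series, and that these series sum to \<open>s\<close>.  Since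
  \<^const>\<open>to_fract\<close> is injective, the family \<open>F\<close> is determined by \<open>Q\<close> on \<open>I\<close>.
\<close>

definition fract_has_sum :: "('i \<Rightarrow> 'a::idom mfps fract) \<Rightarrow> 'i set \<Rightarrow> 'a mfps \<Rightarrow> bool" where
  "fract_has_sum Q I s \<longleftrightarrow> (\<exists>F. (\<forall>i\<in>I. Q i = to_fract (F i)) \<and> (F has_sum s) I)"

section \<open>Partitions\<close>

text \<open>
  Lists are indexed from 0: $\lambda_i$ is \<open>l ! (i - 1)\<close>.  Hence the odd-indexed parts
  $\lambda_1, \lambda_3, \ldots$ are those at even list positions.
\<close>

definition is_partition :: "nat list \<Rightarrow> bool" where
  "is_partition l \<longleftrightarrow> sorted_wrt (\<ge>) l \<and> (\<forall>p\<in>set l. p > 0)"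

definition strict_partition :: "nat list \<Rightarrow> bool" where
  "strict_partition l \<longleftrightarrow> is_partition l \<and> sorted_wrt (>) l"

definition G1 :: "nat list set" where
  "G1 = {l. is_partition l \<and> (\<forall>i. i + 1 < length l \<longrightarrow>
     l ! i - l ! (i + 1) \<ge> 2 \<and> (odd (l ! i) \<longrightarrow> l ! i - l ! (i + 1) \<ge> 3))}"

definition G2 :: "nat list set" where
  "G2 = {l \<in> G1. \<forall>p\<in>set l. p \<ge> 2}"

definition G1' :: "nat list set" where
  "G1' = {l. strict_partition l \<and> (\<forall>i<length l. odd i \<longrightarrow> even (l ! i))}"

definition G2' :: "nat list set" where
  "G2' = {l. strict_partition l \<and> (\<forall>i<length l. even i \<longrightarrow> even (l ! i))}"

definition part_monom :: "nat list \<Rightarrow> 'a::comm_ring_1 mfps" where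
  "part_monom l = (\<Prod>j<length l. mfps_var j ^ (l ! j))"

text \<open>$X_i = x_1 \cdots x_i$, as an element of the field of fractions.\<close>

definition X :: "nat \<Rightarrow> 'a::idom mfps fract" where
  "X i = to_fract (\<Prod>j<i. mfps_var j)"

end

theory Submission
  imports Defs
begin

text \<open>
  The $n$-th summand counts the partitions of length $n$ (for the primed families: of length
  $2n-1$ or $2n$).  Since $x^\lambda = \prod_i X_i^{\lambda_i - \lambda_{i+1}}$, a partition is
  determined by its gaps.  Once the parities of the parts are fixed, the defining conditions say that each
  gap runs through $c_i, c_i + 2, c_i + 4, \ldots$ independently, with generating function
  $\prod_i X_i^{c_i} / (1 - X_i^2)$.  Changing the parity of $\lambda_i$ from its default value raises the
  least gaps $c_{i-1}$ and $c_i$ by 1 each, which multiplies the monomial by $X_{i-1} X_i$; for the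
  last part of the first and fourth families $c_i$ drops by 1 instead, whence $X_{i-1} / X_i$.  Summing over all
  sets of exceptional positions gives the products of the $1 + X_{i-1} X_i$.
\<close>

abbreviation lk :: "(nat \<Rightarrow>\<^sub>0 nat) \<Rightarrow> nat \<Rightarrow> nat" where
  "lk \<equiv> poly_mapping.lookup"

section \<open>Generating functions of sets of monomials\<close>

text \<open>Under this encoding a disjoint union of sets becomes a sum of series and a translate
  becomes a product with a monomial, so the counting can be done on sets of exponent
  vectors.\<close>

definition genfun :: "(nat \<Rightarrow>\<^sub>0 nat) set \<Rightarrow> 'a::comm_ring_1 mfps" where
  "genfun A = Abs_mfps (\<lambda>m. of_bool (m \<in> A))"

lemma mcoeff_genfun [simp]: "mcoeff (genfun A) m = of_bool (m \<in> A)"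
  by (simp add: genfun_def)

lemma genfun_zero: "genfun {0} = 1"
  by (rule mfps_eqI) (simp add: mcoeff_1)

lemma genfun_Un_disjoint: "A \<inter> B = {} \<Longrightarrow> genfun (A \<union> B) = genfun A + genfun B"
  by (rule mfps_eqI) auto

lemma genfun_UN_disjoint:
  assumes "finite D" "disjoint_family_on A D"
  shows "genfun (\<Union>d\<in>D. A d) = (\<Sum>d\<in>D. genfun (A d))"
  using assms
proof (induction D)
  case empty
  then show ?case by (intro mfps_eqI) simp
next
  case (insert d D)
  then have "A d \<inter> (\<Union>d\<in>D. A d) = {}"
    by (auto simp: disjoint_family_on_def)
  moreover have "disjoint_family_on A D"
    using insert.prems by (rule disjoint_family_on_mono[rotated]) auto
  ultimately show ?case
    using insert by (simp add: genfun_Un_disjoint)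
qed

text \<open>A monomial lies in at most one \<open>A i\<close>, so each coefficient receives at most
  one nonzero term and convergence is automatic.\<close>

lemma has_sum_genfun:
  assumes "disjoint_family_on A I"
  shows "((\<lambda>i. genfun (A i)) has_sum (genfun (\<Union>i\<in>I. A i) :: 'a::comm_ring_1 mfps)) I"
  unfolding has_sum_mfps_iff
proof
  fix m
  let ?J = "{i \<in> I. mcoeff (genfun (A i) :: 'a mfps) m \<noteq> 0}"
  have J: "?J = {i \<in> I. m \<in> A i}" by auto
  show "finite ?J \<and> mcoeff (genfun (\<Union>i\<in>I. A i) :: 'a mfps) m = (\<Sum>i\<in>?J. mcoeff (genfun (A i)) m)"
  proof (cases "\<exists>i\<in>I. m \<in> A i")
    case True
    then obtain i where i: "i \<in> I" "m \<in> A i" by auto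
    then have "?J = {i}"
      unfolding J using assms by (fastforce simp: disjoint_family_on_def)
    moreover have "mcoeff (genfun (\<Union>i\<in>I. A i) :: 'a mfps) m = 1" using i by auto
    ultimately show ?thesis using i by simp
  next
    case False
    then have "?J = {}" unfolding J by auto
    moreover have "mcoeff (genfun (\<Union>i\<in>I. A i) :: 'a mfps) m = 0" using False by auto
    ultimately show ?thesis by (simp only: finite.emptyI sum.empty)
  qed
qed

text \<open>By cancellation a monomial has at most one splitting with first component
  \<open>e\<close>.\<close>

lemma genfun_singleton_mult:
  "genfun {e} * genfun A = genfun ((+) e ` A)"
proof (rule mfps_eqI)
  fix m
  have *: "mcoeff (genfun {e} * genfun A) m
      = (\<Sum>(a, b)\<in>splits m. of_bool (a = e \<and> b \<in> A))"
    by (auto simp: mcoeff_mult intro!: sum.cong)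
  show "mcoeff (genfun {e} * genfun A) m = mcoeff (genfun ((+) e ` A)) m"
  proof (cases "m \<in> (+) e ` A")
    case True
    then obtain r where r: "r \<in> A" "m = e + r" by auto
    have "(\<Sum>(a, b)\<in>splits m. of_bool (a = e \<and> b \<in> A))
        = (\<Sum>(a, b)\<in>{(e, r)}. of_bool (a = e \<and> b \<in> A))"
      by (rule sum.mono_neutral_right[OF finite_splits]) (auto simp: splits_def r)
    then show ?thesis unfolding * using r True by simp
  next
    case False
    have "(\<Sum>(a, b)\<in>splits m. of_bool (a = e \<and> b \<in> A)) = 0"
      by (rule sum.neutral) (use False in \<open>auto simp: splits_def\<close>)
    then show ?thesis unfolding * using False by simp
  qed
qed

text \<open>The multiple of \<open>e\<close> is kept as a sum of \<open>n\<close> copies;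
  \<open>sum_constant\<close> would turn it into a product with \<open>of_nat n\<close>.\<close>

lemma genfun_singleton_power: "genfun {e} ^ n = genfun {\<Sum>k<n. e}"
  by (induction n) (simp_all add: genfun_zero genfun_singleton_mult add.commute del: sum_constant)

lemma genfun_singleton_prod:
  "finite J \<Longrightarrow> (\<Prod>j\<in>J. genfun {e j}) = genfun {\<Sum>j\<in>J. e j}"
  by (induction J rule: finite_induct) (simp_all add: genfun_zero genfun_singleton_mult)

section \<open>Variables, partitions and the products \<open>X k\<close> as single monomials\<close>

lemma mfps_var_eq_genfun: "mfps_var j = genfun {Poly_Mapping.single j 1}"
  by (rule mfps_eqI) (simp add: mfps_var_def)

lemma lookup_sum_single:
  "lk (\<Sum>j<n. Poly_Mapping.single j (f j)) k = (if k < n then f k else 0)"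
  by (simp add: lookup_sum lookup_single when_def)

text \<open>\<open>Poly_Mapping.nth\<close> pads a list with zeros to an exponent vector; this is
  how partitions are represented from here on.\<close>

lemma part_monom_eq_genfun: "part_monom l = genfun {Poly_Mapping.nth l}"
proof -
  have single: "(\<Sum>k<n. Poly_Mapping.single j 1) = Poly_Mapping.single j n" for n j :: nat
    by (induction n) (simp_all flip: single_add del: sum_constant)
  have "(\<Sum>j<length l. \<Sum>k<l ! j. Poly_Mapping.single j 1) = Poly_Mapping.nth l"
    unfolding single
    by (rule poly_mapping_eqI) (simp add: lookup_sum_single nth_default_def)
  then show ?thesis
    by (simp add: part_monom_def mfps_var_eq_genfun genfun_singleton_power genfun_singleton_prod
        del: sum_constant)
qed

text \<open>The exponent vector of X_k.\<close>

definition staircase :: "nat \<Rightarrow> nat \<Rightarrow>\<^sub>0 nat" where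
  "staircase k = (\<Sum>j<k. Poly_Mapping.single j 1)"

lemma lookup_staircase [simp]: "lk (staircase k) j = of_bool (j < k)"
  by (simp add: staircase_def lookup_sum_single)

lemma X_eq_genfun: "X k = to_fract (genfun {staircase k})"
  by (simp add: X_def mfps_var_eq_genfun genfun_singleton_prod staircase_def)

lemma genfun_eq_0_iff: "genfun A = 0 \<longleftrightarrow> A = {}"
proof
  assume "(genfun A :: 'a mfps) = 0"
  then have "mcoeff (genfun A :: 'a mfps) m = 0" for m by simp
  then show "A = {}" by auto
qed (auto intro: mfps_eqI)

lemma X_nonzero [simp]: "X k \<noteq> 0"
  by (simp add: X_eq_genfun genfun_eq_0_iff)

lemma X_0 [simp]: "X 0 = 1"
  by (simp add: X_def)

lemma to_fract_power: "to_fract (x ^ n) = to_fract x ^ n"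
  by (induction n) simp_all

lemma lookup_staircase_multiple: "lk (\<Sum>k<n. staircase N) j = (if j < N then n else 0)"
  by (subst lookup_sum) simp

text \<open>The square is a monomial with a positive exponent, so the constant coefficient of the
  difference is 1. The index is a successor because X_0 = 1.\<close>

lemma one_minus_X_power2_nonzero: "1 - X (Suc k) ^ 2 \<noteq> (0 :: 'a::idom mfps fract)"
proof
  assume *: "1 - X (Suc k) ^ 2 = (0 :: 'a mfps fract)"
  let ?e = "\<Sum>i<2::nat. staircase (Suc k)"
  have "to_fract (1 - genfun {?e} :: 'a mfps) = 1 - X (Suc k) ^ 2"
    by (simp add: X_eq_genfun genfun_singleton_power del: sum_constant flip: to_fract_power)
  then have "to_fract (1 - genfun {?e} :: 'a mfps) = to_fract 0"
    using * by simp
  then have "1 - genfun {?e} = (0 :: 'a mfps)"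
    by (simp only: to_fract_eq_iff)
  then have "mcoeff (1 - genfun {?e} :: 'a mfps) 0 = 0" by simp
  then have "?e = 0" by (auto simp: mcoeff_1)
  then have "lk ?e 0 = 0" by (simp only: lookup_zero)
  then show False unfolding lookup_staircase_multiple by simp
qed

lemma mem_translate_iff:
  "m \<in> (+) e ` A \<longleftrightarrow> (\<forall>j. lk e j \<le> lk m j) \<and> m - e \<in> (A :: (nat \<Rightarrow>\<^sub>0 nat) set)"
proof
  assume "m \<in> (+) e ` A"
  then show "(\<forall>j. lk e j \<le> lk m j) \<and> m - e \<in> A" by (auto simp: lookup_add)
next
  assume *: "(\<forall>j. lk e j \<le> lk m j) \<and> m - e \<in> A"
  then have "m = e + (m - e)"
    by (intro poly_mapping_eqI) (simp add: lookup_add lookup_minus)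
  with * show "m \<in> (+) e ` A" by blast
qed

section \<open>Monomials with prescribed gaps modulo two\<close>

text \<open>Gaps are written additively because natural subtraction truncates. Entry
  \<open>N\<close> is 0, so the last gap is the last entry itself; where \<open>c\<close> is 0,
  trailing entries below \<open>N\<close> may vanish.\<close>

definition gap_set :: "nat \<Rightarrow> (nat \<Rightarrow> nat) \<Rightarrow> (nat \<Rightarrow>\<^sub>0 nat) set" where
  "gap_set N c = {m. (\<forall>j\<ge>N. lk m j = 0) \<and> (\<forall>j<N. \<exists>d. lk m j = lk m (Suc j) + c j + 2 * d)}"

lemma gap_setI:
  assumes "\<And>j. N \<le> j \<Longrightarrow> lk m j = 0"
    and "\<And>j. j < N \<Longrightarrow> \<exists>d. lk m j = lk m (Suc j) + c j + 2 * d"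
  shows "m \<in> gap_set N c"
  using assms unfolding gap_set_def by blast

lemma gap_set_zero: "m \<in> gap_set N c \<Longrightarrow> N \<le> j \<Longrightarrow> lk m j = 0"
  unfolding gap_set_def by blast

lemma gap_setE:
  assumes "m \<in> gap_set N c" "j < N"
  obtains d where "lk m j = lk m (Suc j) + c j + 2 * d"
  using assms unfolding gap_set_def by blast

lemma gap_set_antimono:
  assumes "m \<in> gap_set N c"
  shows "lk m (Suc j) \<le> lk m j"
  using assms unfolding gap_set_def by (cases "j < N") (fastforce, simp)

lemma gap_set_ge_last:
  assumes "m \<in> gap_set (Suc N) c" "j \<le> N"
  shows "lk m N \<le> lk m j"
  by (rule lift_Suc_antimono_le[of "lk m", OF gap_set_antimono[OF assms(1)] assms(2)])

text \<open>The last gap equals entry \<open>N\<close>. If it has its least value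
  \<open>c N\<close>, subtracting \<open>c N\<close> from the first \<open>N + 1\<close> entries
  leaves an element of \<open>gap_set N c\<close>. Otherwise it is at least \<open>c N + 2\<close>,
  and subtracting 2 from these entries stays in the same set. Neither subtraction changes the
  earlier gaps.\<close>

lemma gap_set_Suc:
  fixes N :: nat and c :: "nat \<Rightarrow> nat"
  defines "e \<equiv> \<lambda>n::nat. \<Sum>k<n. staircase (Suc N)"
  shows "gap_set (Suc N) c = (+) (e (c N)) ` gap_set N c \<union> (+) (e 2) ` gap_set (Suc N) c"
    and "(+) (e (c N)) ` gap_set N c \<inter> (+) (e 2) ` gap_set (Suc N) c = {}"
proof -
  have e: "lk (e n) j = (if j < Suc N then n else 0)" for n j
    unfolding e_def by (rule lookup_staircase_multiple)
  have first: "m \<in> (+) (e (c N)) ` gap_set N c \<longleftrightarrow> m \<in> gap_set (Suc N) c \<and> lk m N = c N" for m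
  proof
    assume "m \<in> (+) (e (c N)) ` gap_set N c"
    then obtain r where r: "r \<in> gap_set N c" "m = e (c N) + r" by blast
    have m: "lk m j = (if j < Suc N then c N else 0) + lk r j" for j
      by (simp only: r(2) lookup_add e)
    have "m \<in> gap_set (Suc N) c"
    proof (rule gap_setI)
      fix j assume "j < Suc N"
      show "\<exists>d. lk m j = lk m (Suc j) + c j + 2 * d"
      proof (cases "j = N")
        case True
        then show ?thesis
          using gap_set_zero[OF r(1), of N] gap_set_zero[OF r(1), of "Suc N"] by (simp add: m)
      next
        case False
        with \<open>j < Suc N\<close> have "j < N" by simp
        with r(1) obtain d where "lk r j = lk r (Suc j) + c j + 2 * d" by (rule gap_setE)
        with \<open>j < N\<close> show ?thesis by (simp add: m)
      qed
    qed (simp add: m gap_set_zero[OF r(1)])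
    moreover have "lk m N = c N" using gap_set_zero[OF r(1), of N] by (simp add: m)
    ultimately show "m \<in> gap_set (Suc N) c \<and> lk m N = c N" ..
  next
    assume "m \<in> gap_set (Suc N) c \<and> lk m N = c N"
    then have m: "m \<in> gap_set (Suc N) c" and mN: "lk m N = c N" by blast+
    have le: "c N \<le> lk m j" if "j \<le> N" for j
      using gap_set_ge_last[OF m that] mN by simp
    have "m - e (c N) \<in> gap_set N c"
    proof (rule gap_setI)
      fix j assume "N \<le> j"
      then show "lk (m - e (c N)) j = 0"
        using mN gap_set_zero[OF m, of j] by (cases "j = N") (simp_all add: lookup_minus e)
    next
      fix j assume j: "j < N"
      then have "j < Suc N" by simp
      with m obtain d where "lk m j = lk m (Suc j) + c j + 2 * d" by (rule gap_setE)
      then show "\<exists>d. lk (m - e (c N)) j = lk (m - e (c N)) (Suc j) + c j + 2 * d"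
        using le[of "Suc j"] j by (intro exI[of _ d]) (simp add: lookup_minus e)
    qed
    then show "m \<in> (+) (e (c N)) ` gap_set N c"
      using le unfolding mem_translate_iff e by simp
  qed
  have second: "m \<in> (+) (e 2) ` gap_set (Suc N) c \<longleftrightarrow> m \<in> gap_set (Suc N) c \<and> lk m N \<noteq> c N" for m
  proof
    assume "m \<in> (+) (e 2) ` gap_set (Suc N) c"
    then obtain r where r: "r \<in> gap_set (Suc N) c" "m = e 2 + r" by blast
    have m: "lk m j = (if j < Suc N then 2 else 0) + lk r j" for j
      by (simp only: r(2) lookup_add e)
    \<comment> \<open>Adding 2 to the first \<open>N + 1\<close> entries changes only the last gap,
      whose \<open>d\<close> grows by one. The conjunct \<open>0 < d\<close> there is what excludes
      \<open>lk m N = c N\<close>.\<close>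
    have step: "\<exists>d. lk m j = lk m (Suc j) + c j + 2 * d \<and> (j = N \<longrightarrow> 0 < d)" if j: "j < Suc N" for j
    proof -
      obtain d where "lk r j = lk r (Suc j) + c j + 2 * d" using r(1) j by (rule gap_setE)
      then show ?thesis
        using j by (intro exI[of _ "if j = N then Suc d else d"]) (auto simp: m)
    qed
    have "m \<in> gap_set (Suc N) c"
    proof (rule gap_setI)
      show "\<exists>d. lk m j = lk m (Suc j) + c j + 2 * d" if "j < Suc N" for j
        using step[OF that] by blast
    qed (simp add: m gap_set_zero[OF r(1)])
    moreover have "lk m N \<noteq> c N" using step[of N] by auto
    ultimately show "m \<in> gap_set (Suc N) c \<and> lk m N \<noteq> c N" ..
  next
    assume "m \<in> gap_set (Suc N) c \<and> lk m N \<noteq> c N"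
    then have m: "m \<in> gap_set (Suc N) c" and mN: "lk m N \<noteq> c N" by blast+
    have z: "lk m (Suc N) = 0" using gap_set_zero[OF m] by simp
    obtain d where "lk m N = lk m (Suc N) + c N + 2 * d" by (rule gap_setE[OF m, of N]) simp
    with z mN obtain d' where d': "lk m N = c N + 2 * Suc d'" by (cases d) auto
    have le: "2 \<le> lk m j" if "j \<le> N" for j
      using gap_set_ge_last[OF m that] d' by simp
    have "m - e 2 \<in> gap_set (Suc N) c"
    proof (rule gap_setI)
      fix j assume "Suc N \<le> j"
      then show "lk (m - e 2) j = 0"
        using gap_set_zero[OF m, of j] by (simp add: lookup_minus)
    next
      fix j assume j: "j < Suc N"
      show "\<exists>d. lk (m - e 2) j = lk (m - e 2) (Suc j) + c j + 2 * d"
      proof (cases "j = N")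
        case True
        then show ?thesis using d' z by (intro exI[of _ d']) (simp add: lookup_minus e)
      next
        case False
        obtain d where "lk m j = lk m (Suc j) + c j + 2 * d" using m j by (rule gap_setE)
        then show ?thesis
          using le[of "Suc j"] j False by (intro exI[of _ d]) (simp add: lookup_minus e)
      qed
    qed
    then show "m \<in> (+) (e 2) ` gap_set (Suc N) c"
      using le unfolding mem_translate_iff e by simp
  qed
  show "gap_set (Suc N) c = (+) (e (c N)) ` gap_set N c \<union> (+) (e 2) ` gap_set (Suc N) c"
    using first second by blast
  show "(+) (e (c N)) ` gap_set N c \<inter> (+) (e 2) ` gap_set (Suc N) c = {}"
    using first second by blast
qed

lemma fract_genfun_gap_set:
  "to_fract (genfun (gap_set N c)) * (\<Prod>j<N. 1 - X (Suc j) ^ 2) = (\<Prod>j<N. X (Suc j) ^ c j :: 'a::idom mfps fract)"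
proof (induction N)
  case 0
  have "gap_set 0 c = {0}"
    by (auto simp: gap_set_def intro: poly_mapping_eqI)
  then show ?case by (simp add: genfun_zero)
next
  case (Suc N)
  let ?g = "\<lambda>N. to_fract (genfun (gap_set N c)) :: 'a mfps fract"
  \<comment> \<open>The decomposition, in which the same set occurs on both sides, becomes a linear
    equation for its generating function.\<close>
  have "?g (Suc N) = X (Suc N) ^ c N * ?g N + X (Suc N) ^ 2 * ?g (Suc N)"
    by (subst gap_set_Suc(1), subst genfun_Un_disjoint[OF gap_set_Suc(2)])
       (simp add: X_eq_genfun genfun_singleton_power flip: genfun_singleton_mult to_fract_power)
  then have rec: "?g (Suc N) * (1 - X (Suc N) ^ 2) = X (Suc N) ^ c N * ?g N"
    by (simp add: algebra_simps)
  have "?g (Suc N) * (\<Prod>j<Suc N. 1 - X (Suc j) ^ 2)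
      = ?g (Suc N) * (1 - X (Suc N) ^ 2) * (\<Prod>j<N. 1 - X (Suc j) ^ 2)"
    by (simp only: prod.lessThan_Suc mult_ac)
  also have "\<dots> = X (Suc N) ^ c N * (\<Prod>j<N. X (Suc j) ^ c j)"
    unfolding rec mult.assoc Suc ..
  finally show ?case by (simp only: prod.lessThan_Suc mult.commute)
qed

text \<open>Downward induction from entry \<open>N\<close>, which is 0 and hence even: an odd gap
  flips the parity and an even gap keeps it.\<close>

lemma gap_set_parity:
  assumes "m \<in> gap_set N c" "\<And>j. j < N \<Longrightarrow> odd (c j) \<longleftrightarrow> h j \<noteq> h (Suc j)" "\<not> h N" "i \<le> N"
  shows "odd (lk m i) \<longleftrightarrow> h i"
  using assms(4)
proof (induction i rule: inc_induct)
  case base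
  then show ?case using assms(1,3) by (simp add: gap_set_def)
next
  case (step i)
  obtain d where "lk m i = lk m (Suc i) + c i + 2 * d"
    using assms(1) step.hyps unfolding gap_set_def by blast
  then show ?case using step assms(2)[of i] by auto
qed

text \<open>Prescribing gap residues modulo 2 is the same as prescribing parities of entries. Once
  the parities agree, being at least \<open>c j\<close> already makes the excess of a gap over
  \<open>c j\<close> an even number.\<close>

lemma gap_set_iff_parity:
  assumes "\<And>j. j < N \<Longrightarrow> odd (c j) \<longleftrightarrow> h j \<noteq> h (Suc j)" "\<not> h N"
  shows "m \<in> gap_set N c \<longleftrightarrow> (\<forall>j\<ge>N. lk m j = 0) \<and>
    (\<forall>j<N. (odd (lk m j) \<longleftrightarrow> h j) \<and> lk m (Suc j) + c j \<le> lk m j)"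
proof
  assume "m \<in> gap_set N c"
  moreover from this have "\<forall>j<N. odd (lk m j) \<longleftrightarrow> h j"
    using gap_set_parity[where c=c and h=h, OF _ assms] by simp
  ultimately show "(\<forall>j\<ge>N. lk m j = 0) \<and>
    (\<forall>j<N. (odd (lk m j) \<longleftrightarrow> h j) \<and> lk m (Suc j) + c j \<le> lk m j)"
    unfolding gap_set_def by fastforce
next
  assume *: "(\<forall>j\<ge>N. lk m j = 0) \<and>
    (\<forall>j<N. (odd (lk m j) \<longleftrightarrow> h j) \<and> lk m (Suc j) + c j \<le> lk m j)"
  then have h: "odd (lk m j) \<longleftrightarrow> h j" if "j \<le> N" for j
    using that assms(2) by (cases "j = N") auto
  have "\<exists>d. lk m j = lk m (Suc j) + c j + 2 * d" if "j < N" for j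
  proof -
    have "even (lk m j - (lk m (Suc j) + c j))"
      using h[of j] h[of "Suc j"] assms(1)[of j] that * by auto
    moreover have "lk m (Suc j) + c j \<le> lk m j" using * that by blast
    ultimately show ?thesis by (metis dvdE le_add_diff_inverse)
  qed
  with * show "m \<in> gap_set N c" unfolding gap_set_def by blast
qed

text \<open>
  Here \<open>h\<close> gives the default parities, \<open>I\<close> the positions at which the parity may deviate from
  them, \<open>b\<close> the least gaps when no parity deviates, and \<open>s j\<close> the change of the least gap
  below part \<open>j\<close> when its own parity deviates.
\<close>

definition parity_gap_set ::
  "nat \<Rightarrow> nat set \<Rightarrow> (nat \<Rightarrow> int) \<Rightarrow> (nat \<Rightarrow> int) \<Rightarrow> (nat \<Rightarrow> bool) \<Rightarrow> (nat \<Rightarrow>\<^sub>0 nat) set" where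
  "parity_gap_set N I b s h = {m. (\<forall>j\<ge>N. lk m j = 0) \<and>
     (\<forall>j<N. (j \<notin> I \<longrightarrow> (odd (lk m j) \<longleftrightarrow> h j)) \<and>
        int (lk m (Suc j)) + b j + (if odd (lk m j) \<noteq> h j then s j else 0)
          + of_bool (odd (lk m (Suc j)) \<noteq> h (Suc j)) \<le> int (lk m j))}"

text \<open>Split by the set \<open>D\<close> of positions in \<open>I\<close> where the parity
  deviates. For fixed \<open>D\<close> this is a \<open>gap_set\<close>, and expanding the product
  over \<open>I\<close> recovers the sum over all \<open>D\<close>. Oddness of \<open>s\<close>
  makes a deviation flip the parity of the gap below as well as that of the gap above.\<close>

lemma fract_genfun_parity_gap_set:
  fixes b s :: "nat \<Rightarrow> int" and h :: "nat \<Rightarrow> bool"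
  assumes I: "I \<subseteq> {..<N}" and hN: "\<not> h N"
    and hb: "\<And>j. j < N \<Longrightarrow> odd (b j) \<longleftrightarrow> h j \<noteq> h (Suc j)"
    and s: "\<And>j. j \<in> I \<Longrightarrow> odd (s j)"
    and b0: "\<And>j. j < N \<Longrightarrow> 0 \<le> b j" and bs0: "\<And>j. j \<in> I \<Longrightarrow> 0 \<le> b j + s j"
  shows "to_fract (genfun (parity_gap_set N I b s h)) =
    (\<Prod>j<N. X (Suc j) powi b j) * (\<Prod>i\<in>I. 1 + X i * X (Suc i) powi s i)
      / (\<Prod>j<N. 1 - X (Suc j) ^ 2 :: 'a::idom mfps fract)"
proof -
  \<comment> \<open>The least gaps for the deviation set \<open>D\<close>. They are computed in the
    integers since \<open>s j\<close> may be -1; nonnegativity makes the passage to \<open>c\<close>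
    lossless.\<close>
  define ci where "ci D j = b j + (if j \<in> D then s j else 0) + of_bool (Suc j \<in> D)" for D j
  define c where "c D j = nat (ci D j)" for D j
  have fin: "finite I" using I finite_subset by blast
  have c: "int (c D j) = ci D j" if "D \<subseteq> I" "j < N" for D j
    using b0[OF that(2)] bs0[of j] that(1) by (auto simp: c_def ci_def)
  have odd_c: "odd (c D j) \<longleftrightarrow> (h j \<noteq> (j \<in> D)) \<noteq> (h (Suc j) \<noteq> (Suc j \<in> D))"
    if "D \<subseteq> I" "j < N" for D j
  proof -
    have "odd (c D j) \<longleftrightarrow> odd (ci D j)" by (simp flip: c[OF that])
    also have "\<dots> \<longleftrightarrow> (h j \<noteq> (j \<in> D)) \<noteq> (h (Suc j) \<noteq> (Suc j \<in> D))"
      using hb[OF that(2)] s[of j] that(1) by (auto simp: ci_def)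
    finally show ?thesis .
  qed
  have gap: "m \<in> gap_set N (c D) \<longleftrightarrow> (\<forall>j\<ge>N. lk m j = 0) \<and>
      (\<forall>j<N. (odd (lk m j) \<longleftrightarrow> (h j \<noteq> (j \<in> D))) \<and> lk m (Suc j) + c D j \<le> lk m j)"
    if "D \<subseteq> I" for m D
    using that I hN by (intro gap_set_iff_parity odd_c) auto
  \<comment> \<open>The monomial determines \<open>D\<close>, which yields both the union over
    \<open>Pow I\<close> and its disjointness.\<close>
  have D_eq: "D = {i\<in>I. odd (lk m i) \<noteq> h i}" if "D \<subseteq> I" "m \<in> gap_set N (c D)" for m D
    using that I unfolding gap[OF that(1)] by blast
  have union: "parity_gap_set N I b s h = (\<Union>D\<in>Pow I. gap_set N (c D))"
  proof (intro set_eqI)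
    fix m
    define D where "D = {i\<in>I. odd (lk m i) \<noteq> h i}"
    have "D \<subseteq> I" by (auto simp: D_def)
    have "m \<in> (\<Union>D\<in>Pow I. gap_set N (c D)) \<longleftrightarrow> m \<in> gap_set N (c D)"
      using D_eq \<open>D \<subseteq> I\<close> unfolding D_def by blast
    also have "\<dots> \<longleftrightarrow> m \<in> parity_gap_set N I b s h"
    proof -
      have le: "lk m (Suc j) + c D j \<le> lk m j \<longleftrightarrow>
          int (lk m (Suc j)) + b j + (if odd (lk m j) \<noteq> h j then s j else 0)
          + of_bool (odd (lk m (Suc j)) \<noteq> h (Suc j)) \<le> int (lk m j)"
        if z: "\<forall>j\<ge>N. lk m j = 0" and p: "\<forall>j<N. j \<notin> I \<longrightarrow> (odd (lk m j) \<longleftrightarrow> h j)" and j: "j < N" for j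
      proof -
        have "j \<in> D \<longleftrightarrow> odd (lk m j) \<noteq> h j" using p j by (auto simp: D_def)
        \<comment> \<open>At \<open>Suc j = N\<close> both sides are false: \<open>N\<close> is
          outside \<open>I\<close>, entry \<open>N\<close> is 0 and \<open>h N\<close> is
          false.\<close>
        moreover have "Suc j \<in> D \<longleftrightarrow> odd (lk m (Suc j)) \<noteq> h (Suc j)"
          using p[rule_format, of "Suc j"] j z hN I by (cases "Suc j = N") (auto simp: D_def)
        ultimately have "ci D j = b j + (if odd (lk m j) \<noteq> h j then s j else 0)
          + of_bool (odd (lk m (Suc j)) \<noteq> h (Suc j))" by (simp add: ci_def)
        then show ?thesis using c[OF \<open>D \<subseteq> I\<close> j] by linarith
      qed
      have p: "(odd (lk m j) \<longleftrightarrow> (h j \<noteq> (j \<in> D))) \<longleftrightarrow> (j \<notin> I \<longrightarrow> (odd (lk m j) \<longleftrightarrow> h j))" for j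
        by (auto simp: D_def)
      show ?thesis
        unfolding gap[OF \<open>D \<subseteq> I\<close>] parity_gap_set_def mem_Collect_eq p using le by blast
    qed
    finally show "m \<in> parity_gap_set N I b s h \<longleftrightarrow> m \<in> (\<Union>D\<in>Pow I. gap_set N (c D))" ..
  qed
  have disj: "disjoint_family_on (\<lambda>D. gap_set N (c D)) (Pow I)"
    unfolding disjoint_family_on_def using D_eq by blast
  have monom: "(\<Prod>j<N. X (Suc j) ^ c D j :: 'a mfps fract) =
      (\<Prod>j<N. X (Suc j) powi b j) * (\<Prod>i\<in>D. X i * X (Suc i) powi s i)" if D: "D \<subseteq> I" for D
  proof -
    have DN: "D \<subseteq> {..<N}" using D I by blast
    have "(\<Prod>j<N. X (Suc j) ^ c D j :: 'a mfps fract) = (\<Prod>j<N. X (Suc j) powi ci D j)"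
      by (intro prod.cong) (simp_all flip: c[OF D])
    also have "\<dots> = (\<Prod>j<N. X (Suc j) powi b j * (if j \<in> D then X (Suc j) powi s j else 1)
        * (if Suc j \<in> D then X (Suc j) else 1))"
      by (intro prod.cong) (auto simp: ci_def power_int_add)
    also have "\<dots> = (\<Prod>j<N. X (Suc j) powi b j) * (\<Prod>j<N. if j \<in> D then X (Suc j) powi s j else 1)
        * (\<Prod>j<N. if Suc j \<in> D then X (Suc j) else 1)"
      by (simp only: prod.distrib)
    also have "(\<Prod>j<N. if j \<in> D then X (Suc j) powi s j else 1) = (\<Prod>j\<in>D. X (Suc j) powi s j :: 'a mfps fract)"
      using DN by (intro prod.mono_neutral_cong_right) auto
    \<comment> \<open>The shifted product gains a factor at \<open>j = 0\<close>, which is harmless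
      because \<open>X 0 = 1\<close>.\<close>
    also have "(\<Prod>j<N. if Suc j \<in> D then X (Suc j) else 1)
        = (\<Prod>j<Suc N. if j \<in> D then X j else 1 :: 'a mfps fract)"
      by (simp add: prod.lessThan_Suc_shift del: prod.lessThan_Suc)
    also have "\<dots> = (\<Prod>j\<in>D. X j)"
      using DN by (intro prod.mono_neutral_cong_right) auto
    finally show ?thesis by (simp add: prod.distrib mult_ac)
  qed
  have "to_fract (genfun (parity_gap_set N I b s h)) * (\<Prod>j<N. 1 - X (Suc j) ^ 2)
      = (\<Sum>D\<in>Pow I. to_fract (genfun (gap_set N (c D))) * (\<Prod>j<N. 1 - X (Suc j) ^ 2) :: 'a mfps fract)"
    unfolding union using fin
    by (simp add: genfun_UN_disjoint[OF _ disj] sum_distrib_right)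
  also have "\<dots> = (\<Sum>D\<in>Pow I. (\<Prod>j<N. X (Suc j) powi b j) * (\<Prod>i\<in>D. X i * X (Suc i) powi s i))"
    by (intro sum.cong) (auto simp: fract_genfun_gap_set monom)
  also have "\<dots> = (\<Prod>j<N. X (Suc j) powi b j) * (\<Prod>i\<in>I. 1 + X i * X (Suc i) powi s i)"
    using prod_add[OF fin, of "\<lambda>i. X i * X (Suc i) powi s i :: 'a mfps fract" "\<lambda>_. 1"]
    by (simp add: add.commute flip: sum_distrib_left)
  finally show ?thesis
    by (subst nonzero_eq_divide_eq) (use one_minus_X_power2_nonzero in auto)
qed

section \<open>Partitions as exponent vectors\<close>

lemma lookup_nth_pos_iff:
  assumes "is_partition l"
  shows "0 < lk (Poly_Mapping.nth l) j \<longleftrightarrow> j < length l"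
  using assms by (auto simp: is_partition_def nth_default_def)

text \<open>Padding by zeros loses nothing, since all parts are positive and the length can be read
  off the support.\<close>

lemma inj_on_nth_partition: "inj_on Poly_Mapping.nth (Collect is_partition)"
proof (rule inj_onI)
  fix l l' :: "nat list"
  assume *: "l \<in> Collect is_partition" "l' \<in> Collect is_partition" "Poly_Mapping.nth l = Poly_Mapping.nth l'"
  then have "j < length l \<longleftrightarrow> j < length l'" for j
    by (metis lookup_nth_pos_iff mem_Collect_eq)
  then have len: "length l = length l'" by (metis linorder_neqE_nat less_irrefl)
  moreover have "l ! j = l' ! j" if "j < length l" for j
    using arg_cong[OF *(3), of "\<lambda>m. lk m j"] that len by (simp add: nth_default_def)
  ultimately show "l = l'" by (rule nth_equalityI)
qed

lemma nth_partition_antimono: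
  assumes "is_partition l"
  shows "lk (Poly_Mapping.nth l) (Suc j) \<le> lk (Poly_Mapping.nth l) j"
  using assms by (auto simp: is_partition_def nth_default_def sorted_wrt_iff_nth_less)

text \<open>Lets each family be handled as a set of weakly decreasing exponent vectors: such a
  vector is cut at its first zero to recover the list.\<close>

lemma nth_image_partition:
  assumes "\<And>l. l \<in> S \<longleftrightarrow> is_partition l \<and> P (Poly_Mapping.nth l)"
  shows "Poly_Mapping.nth ` S = {m. (\<forall>j. lk m (Suc j) \<le> lk m j) \<and> P m}"
proof (intro equalityI subsetI)
  fix m assume "m \<in> Poly_Mapping.nth ` S"
  then show "m \<in> {m. (\<forall>j. lk m (Suc j) \<le> lk m j) \<and> P m}"
    using assms nth_partition_antimono by blast
next
  fix m assume "m \<in> {m. (\<forall>j. lk m (Suc j) \<le> lk m j) \<and> P m}"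
  then have mono: "\<And>j. lk m (Suc j) \<le> lk m j" and "P m" by auto
  have anti: "lk m j \<le> lk m i" if "i \<le> j" for i j
    by (rule lift_Suc_antimono_le[of "lk m", OF mono that])
  \<comment> \<open>Finite support supplies some zero entry; the first one is the length of the
    partition.\<close>
  obtain N where N: "Poly_Mapping.keys m \<subseteq> {..<N}"
    using finite_nat_iff_bounded by (metis finite_keys)
  then have "lk m N = 0" by (metis in_keys_iff lessThan_iff less_irrefl subsetD)
  define n where "n = (LEAST n. lk m n = 0)"
  have n0: "lk m n = 0" unfolding n_def by (rule LeastI[of _ N]) fact
  have pos: "0 < lk m j" if "j < n" for j
    using not_less_Least[of j "\<lambda>n. lk m n = 0"] that unfolding n_def by blast
  let ?l = "map (lk m) [0..<n]"
  have "Poly_Mapping.nth ?l = m"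
    using anti[of n] n0 by (intro poly_mapping_eqI) (auto simp: nth_default_def)
  moreover have "is_partition ?l"
    using pos anti by (auto simp: is_partition_def sorted_wrt_iff_nth_less)
  ultimately show "m \<in> Poly_Mapping.nth ` S"
    using assms[of ?l] \<open>P m\<close> by (metis image_eqI)
qed

section \<open>The four families as conditions on exponent vectors\<close>

lemma nth_partition_cases:
  assumes "is_partition l"
  shows "j < length l \<Longrightarrow> lk (Poly_Mapping.nth l) j = l ! j \<and> 0 < l ! j"
    and "\<not> j < length l \<Longrightarrow> lk (Poly_Mapping.nth l) j = 0"
  using assms by (auto simp: is_partition_def nth_default_def)

text \<open>The guard \<open>0 < lk m (Suc j)\<close> replaces the length bound, so that the last
  part is not compared with the zero after it.\<close>

lemma nth_image_G1:
  "Poly_Mapping.nth ` G1 = {m. (\<forall>j. lk m (Suc j) \<le> lk m j) \<and>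
     (\<forall>j. 0 < lk m (Suc j) \<longrightarrow> lk m (Suc j) + 2 + of_bool (odd (lk m j)) \<le> lk m j)}"
proof (rule nth_image_partition)
  fix l
  have "(i + 1 < length l \<longrightarrow> l ! i - l ! (i + 1) \<ge> 2 \<and> (odd (l ! i) \<longrightarrow> l ! i - l ! (i + 1) \<ge> 3))
    \<longleftrightarrow> (0 < lk (Poly_Mapping.nth l) (Suc i) \<longrightarrow> lk (Poly_Mapping.nth l) (Suc i) + 2
      + of_bool (odd (lk (Poly_Mapping.nth l) i)) \<le> lk (Poly_Mapping.nth l) i)"
    if "is_partition l" for i
    unfolding lookup_nth_pos_iff[OF that] by (auto simp: nth_default_def)
  then show "l \<in> G1 \<longleftrightarrow> is_partition l \<and> (\<forall>j. 0 < lk (Poly_Mapping.nth l) (Suc j) \<longrightarrow>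
      lk (Poly_Mapping.nth l) (Suc j) + 2 + of_bool (odd (lk (Poly_Mapping.nth l) j))
        \<le> lk (Poly_Mapping.nth l) j)"
    unfolding G1_def by blast
qed

lemma nth_image_G2:
  "Poly_Mapping.nth ` G2 = {m. (\<forall>j. lk m (Suc j) \<le> lk m j) \<and> (\<forall>j. lk m j \<noteq> 1) \<and>
     (\<forall>j. 0 < lk m (Suc j) \<longrightarrow> lk m (Suc j) + 2 + of_bool (odd (lk m j)) \<le> lk m j)}"
proof -
  have "(\<forall>p\<in>set l. p \<ge> 2) \<longleftrightarrow> (\<forall>j. lk (Poly_Mapping.nth l) j \<noteq> 1)" if l: "is_partition l" for l
  proof -
    have "l ! j \<ge> 2 \<longleftrightarrow> lk (Poly_Mapping.nth l) j \<noteq> 1" if "j < length l" for j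
      using nth_partition_cases(1)[OF l that] by auto
    then show ?thesis
      unfolding all_set_conv_all_nth using nth_partition_cases(2)[OF l] by (metis zero_neq_one)
  qed
  moreover have "l \<in> G1 \<Longrightarrow> is_partition l" for l by (simp add: G1_def)
  ultimately have "G2 = {l \<in> G1. \<forall>j. lk (Poly_Mapping.nth l) j \<noteq> 1}"
    unfolding G2_def by blast
  then have "Poly_Mapping.nth ` G2 = {m \<in> Poly_Mapping.nth ` G1. \<forall>j. lk m j \<noteq> 1}" by blast
  then show ?thesis unfolding nth_image_G1 by blast
qed

text \<open>By transitivity neighbours suffice. Comparing the last part with the zero after it is
  harmless, as parts are positive.\<close>

lemma strict_partition_iff:
  "strict_partition l \<longleftrightarrow> is_partition l \<and>
    (\<forall>j. 0 < lk (Poly_Mapping.nth l) j \<longrightarrow> lk (Poly_Mapping.nth l) (Suc j) < lk (Poly_Mapping.nth l) j)"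
proof -
  have "sorted_wrt (>) l \<longleftrightarrow> (\<forall>j. 0 < lk (Poly_Mapping.nth l) j \<longrightarrow>
      lk (Poly_Mapping.nth l) (Suc j) < lk (Poly_Mapping.nth l) j)" if l: "is_partition l"
  proof -
    have "(Suc j < length l \<longrightarrow> l ! Suc j < l ! j) \<longleftrightarrow> (0 < lk (Poly_Mapping.nth l) j \<longrightarrow>
      lk (Poly_Mapping.nth l) (Suc j) < lk (Poly_Mapping.nth l) j)" for j
      using nth_partition_cases[OF l, of j] nth_partition_cases[OF l, of "Suc j"]
      by (cases "j < length l"; cases "Suc j < length l") auto
    moreover have "transp ((>) :: nat \<Rightarrow> nat \<Rightarrow> bool)" by (auto intro: transpI)
    ultimately show ?thesis by (simp only: sorted_wrt_iff_nth_Suc_transp)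
  qed
  then show ?thesis unfolding strict_partition_def by blast
qed

text \<open>Covers both primed families through \<open>Q\<close>; the padding zeros are even and
  satisfy the parity condition.\<close>

lemma nth_image_strict_even:
  "Poly_Mapping.nth ` {l. strict_partition l \<and> (\<forall>i<length l. Q i \<longrightarrow> even (l ! i))} =
    {m. (\<forall>j. lk m (Suc j) \<le> lk m j) \<and>
      (\<forall>j. (0 < lk m j \<longrightarrow> lk m (Suc j) < lk m j) \<and> (Q j \<longrightarrow> even (lk m j)))}"
proof (rule nth_image_partition)
  fix l
  have "(i < length l \<longrightarrow> Q i \<longrightarrow> even (l ! i)) \<longleftrightarrow> (Q i \<longrightarrow> even (lk (Poly_Mapping.nth l) i))" for i
    by (simp add: nth_default_def)
  then show "l \<in> {l. strict_partition l \<and> (\<forall>i<length l. Q i \<longrightarrow> even (l ! i))} \<longleftrightarrow> is_partition l \<and>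
      (\<forall>j. (0 < lk (Poly_Mapping.nth l) j \<longrightarrow> lk (Poly_Mapping.nth l) (Suc j) < lk (Poly_Mapping.nth l) j)
        \<and> (Q j \<longrightarrow> even (lk (Poly_Mapping.nth l) j)))"
    unfolding mem_Collect_eq strict_partition_iff by blast
qed

text \<open>Reduces an identity to its single summands. Nonempty partitions are grouped in blocks of
  \<open>t\<close> consecutive lengths, the n-th block having length above
  \<open>t * (n - 1)\<close> and at most \<open>t * n\<close>; the empty partition gives the
  1.\<close>

lemma partition_identity:
  fixes T :: "nat \<Rightarrow> 'a::idom mfps fract" and t :: nat
  assumes G: "G \<subseteq> Collect is_partition" "[] \<in> G" and "t > 0"
    and T: "\<And>k. T (Suc k) = to_fract (genfun
      {m \<in> Poly_Mapping.nth ` G. 0 < lk m (t * k) \<and> lk m (t * Suc k) = 0})"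
  shows "\<exists>S. (part_monom has_sum (1 + S)) G \<and> fract_has_sum T {1..} S"
proof -
  define A where "A n = {m \<in> Poly_Mapping.nth ` G. 0 < lk m (t * (n - 1)) \<and> lk m (t * n) = 0}" for n
  have anti: "lk m j \<le> lk m i" if "m \<in> Poly_Mapping.nth ` G" "i \<le> j" for m i j
    by (rule lift_Suc_antimono_le[of "lk m", OF _ that(2)]) (use that(1) nth_partition_antimono G in blast)
  have disj: "disjoint_family_on A {1..}"
  proof -
    have "A n \<inter> A n' = {}" if "n < n'" for n n'
    proof -
      \<comment> \<open>An earlier block forces entry \<open>t * n\<close> to be 0, while a later
        one needs a positive entry at or beyond that position.\<close>
      have "t * n \<le> t * (n' - 1)" using that by (intro mult_le_mono2) simp
      then have "m \<notin> A n'" if "m \<in> A n" for m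
        using anti[of m "t * n" "t * (n' - 1)"] that unfolding A_def by simp
      then show ?thesis by blast
    qed
    then show ?thesis
      unfolding disjoint_family_on_def by (metis Int_commute linorder_neqE_nat)
  qed
  have union: "Poly_Mapping.nth ` G = {0} \<union> (\<Union>n\<in>{1..}. A n)"
  proof (intro equalityI subsetI)
    fix m assume m: "m \<in> Poly_Mapping.nth ` G"
    show "m \<in> {0} \<union> (\<Union>n\<in>{1..}. A n)"
    proof (cases "lk m 0 = 0")
      case True
      then have "m = 0" using anti[OF m, of 0] by (intro poly_mapping_eqI) simp
      then show ?thesis by simp
    next
      case False
      define n where "n = (LEAST n. lk m (t * n) = 0)"
      obtain N where "Poly_Mapping.keys m \<subseteq> {..<N}"
        using finite_nat_iff_bounded by (metis finite_keys)
      then have "lk m N = 0" by (metis in_keys_iff lessThan_iff less_irrefl subsetD)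
      moreover have "N \<le> t * N" using \<open>t > 0\<close> by simp
      ultimately have "lk m (t * N) = 0" using anti[OF m, of N "t * N"] by simp
      then have n0: "lk m (t * n) = 0" unfolding n_def by (rule LeastI)
      then have "n \<ge> 1" using False by (cases n) auto
      moreover have "lk m (t * (n - 1)) \<noteq> 0"
        using not_less_Least[of "n - 1" "\<lambda>n. lk m (t * n) = 0"] \<open>n \<ge> 1\<close> unfolding n_def by simp
      ultimately show ?thesis using n0 m by (auto simp: A_def)
    qed
  next
    fix m assume "m \<in> {0} \<union> (\<Union>n\<in>{1..}. A n)"
    moreover have "0 \<in> Poly_Mapping.nth ` G" using G(2) by (force simp: image_iff)
    ultimately show "m \<in> Poly_Mapping.nth ` G" by (auto simp: A_def)
  qed
  let ?S = "genfun (\<Union>n\<in>{1..}. A n) :: 'a mfps"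
  have "disjoint_family_on (\<lambda>l. {Poly_Mapping.nth l}) G"
    using inj_on_subset[OF inj_on_nth_partition G(1)]
    by (auto simp: disjoint_family_on_def inj_on_def)
  from has_sum_genfun[OF this]
  have "(part_monom has_sum (genfun (Poly_Mapping.nth ` G) :: 'a mfps)) G"
    by (simp add: part_monom_eq_genfun[abs_def] UNION_singleton_eq_range)
  moreover have "genfun (Poly_Mapping.nth ` G) = 1 + ?S"
    unfolding union by (subst genfun_Un_disjoint) (auto simp: A_def genfun_zero)
  moreover have "T n = to_fract (genfun (A n))" if "n \<in> {1..}" for n
    using T[of "n - 1"] that by (cases n) (simp_all add: A_def)
  ultimately show ?thesis
    unfolding fract_has_sum_def using has_sum_genfun[OF disj] by (intro exI[of _ ?S]) auto
qed

section \<open>The four families\<close>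

lemma antimono_zero_iff:
  fixes f :: "nat \<Rightarrow> nat"
  assumes "\<And>j. f (Suc j) \<le> f j"
  shows "f N = 0 \<longleftrightarrow> (\<forall>j\<ge>N. f j = 0)"
  using lift_Suc_antimono_le[of f, OF assms] by (metis le_zero_eq order_refl)

lemma antimono_if_eventually_zero:
  fixes f :: "nat \<Rightarrow> nat"
  assumes "\<forall>j\<ge>N. f j = 0" "\<And>j. j < N \<Longrightarrow> f (Suc j) \<le> f j"
  shows "f (Suc j) \<le> f j"
  using assms by (cases "j < N") auto

text \<open>The default is all parts even with gaps 2, and every parity may deviate. An odd part
  needs 3 instead of 2 below it, an odd neighbour below rounds the gap up by 1. The last part is at
  least 2 if even but only 1 if odd, whence the -1.\<close>

lemma G1_class:
  "{m \<in> Poly_Mapping.nth ` G1. 0 < lk m k \<and> lk m (Suc k) = 0} =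
    parity_gap_set (Suc k) {..<Suc k} (\<lambda>_. 2) (\<lambda>j. if j = k then - 1 else 1) (\<lambda>_. False)"
    (is "?L = ?R")
proof (intro equalityI subsetI)
  fix m assume "m \<in> ?L"
  then have mono: "\<And>j. lk m (Suc j) \<le> lk m j" and k: "0 < lk m k" "lk m (Suc k) = 0"
    and gap: "\<And>j. 0 < lk m (Suc j) \<Longrightarrow> lk m (Suc j) + 2 + of_bool (odd (lk m j)) \<le> lk m j"
    unfolding nth_image_G1 by auto
  \<comment> \<open>If entry \<open>Suc j\<close> is odd, the bound from \<open>gap\<close> has the
    wrong parity for the gap and improves by 1.\<close>
  have gap2: "lk m (Suc j) + 2 + of_bool (odd (lk m j)) + of_bool (odd (lk m (Suc j))) \<le> lk m j" if "j < k" for j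
  proof -
    have "0 < lk m (Suc j)"
      using lift_Suc_antimono_le[of "lk m" "Suc j" k, OF mono] k that by simp
    from gap[OF this] show ?thesis
      by (cases "odd (lk m j)"; cases "odd (lk m (Suc j))"; simp; presburger)
  qed
  have "int (lk m (Suc j)) + 2 + (if odd (lk m j) \<noteq> False then if j = k then - 1 else 1 else 0)
      + of_bool (odd (lk m (Suc j)) \<noteq> False) \<le> int (lk m j)" if "j < Suc k" for j
  proof (cases "j = k")
    case True
    with k show ?thesis by (cases "odd (lk m j)"; simp; presburger)
  next
    case False
    with that gap2[of j] show ?thesis
      by (cases "odd (lk m j)"; cases "odd (lk m (Suc j))") auto
  qed
  moreover have "\<forall>j\<ge>Suc k. lk m j = 0"
    using antimono_zero_iff[of "lk m", OF mono] k(2) by blast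
  ultimately show "m \<in> ?R"
    unfolding parity_gap_set_def by simp
next
  fix m assume "m \<in> ?R"
  then have z: "\<forall>j\<ge>Suc k. lk m j = 0"
    and gap': "\<And>j. j < Suc k \<Longrightarrow> int (lk m (Suc j)) + 2
      + (if odd (lk m j) \<noteq> False then if j = k then - 1 else 1 else 0)
      + of_bool (odd (lk m (Suc j)) \<noteq> False) \<le> int (lk m j)"
    unfolding parity_gap_set_def by blast+
  have gap: "lk m (Suc j) + 2 + of_bool (odd (lk m j)) + of_bool (odd (lk m (Suc j))) \<le> lk m j"
    if "j < k" for j
    using gap'[of j] that by (cases "odd (lk m j)"; cases "odd (lk m (Suc j))") auto
  \<comment> \<open>Even the lowered least gap 2 - 1 is positive.\<close>
  have k: "0 < lk m k"
    using gap'[of k] by (cases "lk m k = 0"; cases "odd (lk m (Suc k))") auto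
  have "lk m (Suc j) \<le> lk m j" if "j < Suc k" for j
    using gap[of j] z that by (cases "j = k") auto
  with z have "lk m (Suc j) \<le> lk m j" for j
    by (rule antimono_if_eventually_zero)
  moreover have "lk m (Suc j) + 2 + of_bool (odd (lk m j)) \<le> lk m j" if "0 < lk m (Suc j)" for j
    using gap[of j] z that by (cases "j < k") auto
  ultimately show "m \<in> ?L"
    unfolding nth_image_G1 using z k by blast
qed

text \<open>As for \<open>G1\<close>, except that an odd last part is now at least 3, so the last
  position follows the general rule.\<close>

lemma G2_class:
  "{m \<in> Poly_Mapping.nth ` G2. 0 < lk m k \<and> lk m (Suc k) = 0} =
    parity_gap_set (Suc k) {..<Suc k} (\<lambda>_. 2) (\<lambda>_. 1) (\<lambda>_. False)"
    (is "?L = ?R")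
proof (intro equalityI subsetI)
  fix m assume "m \<in> ?L"
  then have mono: "\<And>j. lk m (Suc j) \<le> lk m j" and k: "0 < lk m k" "lk m (Suc k) = 0" "lk m k \<noteq> 1"
    and gap: "\<And>j. 0 < lk m (Suc j) \<Longrightarrow> lk m (Suc j) + 2 + of_bool (odd (lk m j)) \<le> lk m j"
    unfolding nth_image_G2 by auto
  have gap2: "lk m (Suc j) + 2 + of_bool (odd (lk m j)) + of_bool (odd (lk m (Suc j))) \<le> lk m j" if "j < Suc k" for j
  proof (cases "j = k")
    case True
    with k show ?thesis by (cases "odd (lk m j)"; simp; presburger)
  next
    case False
    then have "0 < lk m (Suc j)"
      using lift_Suc_antimono_le[of "lk m" "Suc j" k, OF mono] k that by simp
    from gap[OF this] show ?thesis
      by (cases "odd (lk m j)"; cases "odd (lk m (Suc j))"; simp; presburger)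
  qed
  have "int (lk m (Suc j)) + 2 + (if odd (lk m j) \<noteq> False then 1 else 0)
      + of_bool (odd (lk m (Suc j)) \<noteq> False) \<le> int (lk m j)" if "j < Suc k" for j
    using that gap2[of j]
    by (cases "odd (lk m j)"; cases "odd (lk m (Suc j))") auto
  moreover have "\<forall>j\<ge>Suc k. lk m j = 0"
    using antimono_zero_iff[of "lk m", OF mono] k(2) by blast
  ultimately show "m \<in> ?R"
    unfolding parity_gap_set_def by simp
next
  fix m assume "m \<in> ?R"
  then have z: "\<forall>j\<ge>Suc k. lk m j = 0"
    and gap': "\<And>j. j < Suc k \<Longrightarrow> int (lk m (Suc j)) + 2 + (if odd (lk m j) \<noteq> False then 1 else 0)
      + of_bool (odd (lk m (Suc j)) \<noteq> False) \<le> int (lk m j)"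
    unfolding parity_gap_set_def by blast+
  have gap: "lk m (Suc j) + 2 + of_bool (odd (lk m j)) + of_bool (odd (lk m (Suc j))) \<le> lk m j"
    if "j < Suc k" for j
    using gap'[of j] that by (cases "odd (lk m j)"; cases "odd (lk m (Suc j))") auto
  have "lk m (Suc j) \<le> lk m j" if "j < Suc k" for j
    using gap[of j] that by auto
  with z have "lk m (Suc j) \<le> lk m j" for j
    by (rule antimono_if_eventually_zero)
  moreover have "lk m j \<noteq> 1" for j
    using gap[of j] z by (cases "j < Suc k") auto
  moreover have "lk m (Suc j) + 2 + of_bool (odd (lk m j)) \<le> lk m j" if "0 < lk m (Suc j)" for j
    using gap[of j] z that by (cases "j < Suc k") auto
  ultimately show "m \<in> ?L"
    unfolding nth_image_G2 using z gap[of k] by auto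
qed

text \<open>Lengths \<open>2 * k + 1\<close> and \<open>2 * k + 2\<close> are treated together. List
  positions \<open>2 * i\<close> are free and odd by default, the others are forced to be even, so
  default gaps are 1. The last gap is an even entry that may be 0. Making a free part even raises
  both adjacent gaps to 2. The bound in \<open>h\<close> keeps the default at the end even, as the
  zero there requires.\<close>

lemma G1'_class:
  "{m \<in> Poly_Mapping.nth ` G1'. 0 < lk m (2 * k) \<and> lk m (2 * Suc k) = 0} =
    parity_gap_set (2 * Suc k) ((\<lambda>i. 2 * i) ` {..<Suc k}) (\<lambda>j. if j = 2 * k + 1 then 0 else 1)
      (\<lambda>_. 1) (\<lambda>j. j < 2 * Suc k \<and> even j)"
    (is "?L = ?R")
proof (intro equalityI subsetI)
  have I: "j \<in> (\<lambda>i. 2 * i) ` {..<Suc k} \<longleftrightarrow> j < 2 * Suc k \<and> even j" for j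
    by (auto elim!: evenE)
  {
    fix m assume "m \<in> ?L"
    then have mono: "\<And>j. lk m (Suc j) \<le> lk m j" and k: "0 < lk m (2 * k)" "lk m (2 * Suc k) = 0"
      and strict: "\<And>j. 0 < lk m j \<Longrightarrow> lk m (Suc j) < lk m j"
      and ev: "\<And>j. odd j \<Longrightarrow> even (lk m j)"
      unfolding G1'_def nth_image_strict_even by auto
    have "int (lk m (Suc j)) + (if j = 2 * k + 1 then 0 else 1)
        + (if odd (lk m j) \<noteq> (j < 2 * Suc k \<and> even j) then 1 else 0)
        + of_bool (odd (lk m (Suc j)) \<noteq> (Suc j < 2 * Suc k \<and> even (Suc j))) \<le> int (lk m j)"
      if "j < 2 * Suc k" for j
    proof (cases "j = 2 * k + 1")
      case True
      then show ?thesis using k ev[of j] by simp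
    next
      case False
      then have j: "j \<le> 2 * k" using that by simp
      then have "0 < lk m j" using lift_Suc_antimono_le[of "lk m" j "2 * k", OF mono] k by simp
      from strict[OF this] show ?thesis
        using False j ev[of j] ev[of "Suc j"]
        by (cases "even j"; cases "even (lk m j)"; cases "even (lk m (Suc j))"; simp; presburger)
    qed
    then show "m \<in> ?R"
      using antimono_zero_iff[of "lk m", OF mono] k ev
      unfolding parity_gap_set_def I by blast
  next
    fix m assume "m \<in> ?R"
    then have z: "\<forall>j\<ge>2 * Suc k. lk m j = 0"
      and ev: "\<And>j. j < 2 * Suc k \<Longrightarrow> odd j \<Longrightarrow> even (lk m j)"
      and gap: "\<And>j. j < 2 * Suc k \<Longrightarrow> int (lk m (Suc j)) + (if j = 2 * k + 1 then 0 else 1)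
        + (if odd (lk m j) \<noteq> (j < 2 * Suc k \<and> even j) then 1 else 0)
        + of_bool (odd (lk m (Suc j)) \<noteq> (Suc j < 2 * Suc k \<and> even (Suc j))) \<le> int (lk m j)"
      unfolding parity_gap_set_def I by blast+
    have lt: "lk m (Suc j) < lk m j" if "j \<le> 2 * k" for j
      using gap[of j] that by (simp add: of_bool_def split: if_splits)
    have "lk m (Suc j) \<le> lk m j" if "j < 2 * Suc k" for j
      using lt[of j] z that by (cases "j = 2 * k + 1") auto
    with z have mono: "lk m (Suc j) \<le> lk m j" for j
      by (rule antimono_if_eventually_zero)
    \<comment> \<open>At \<open>j = 2 * k + 1\<close> the next entry is 0, so strictness is the
      assumed positivity.\<close>
    have "lk m (Suc j) < lk m j" if "0 < lk m j" for j
      using lt[of j] z that by (cases "j \<le> 2 * k"; cases "j = 2 * k + 1") auto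
    moreover have "even (lk m j)" if "odd j" for j
      using ev[of j] z that by (cases "j < 2 * Suc k") auto
    moreover have "0 < lk m (2 * k)" using lt[of "2 * k"] by simp
    ultimately show "m \<in> ?L"
      unfolding G1'_def nth_image_strict_even using z mono by blast
  }
qed

text \<open>Now the free positions are \<open>2 * i + 1\<close>, again odd by default. The last one
  is at least 1 if odd, but as an even entry it may be 0, which is the case of length
  \<open>2 * k + 1\<close>; hence the -1 there.\<close>

lemma G2'_class:
  "{m \<in> Poly_Mapping.nth ` G2'. 0 < lk m (2 * k) \<and> lk m (2 * Suc k) = 0} =
    parity_gap_set (2 * Suc k) ((\<lambda>i. Suc (2 * i)) ` {..<Suc k}) (\<lambda>_. 1)
      (\<lambda>j. if j = 2 * k + 1 then - 1 else 1) (\<lambda>j. j < 2 * Suc k \<and> odd j)"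
    (is "?L = ?R")
proof (intro equalityI subsetI)
  have I: "j \<in> (\<lambda>i. Suc (2 * i)) ` {..<Suc k} \<longleftrightarrow> j < 2 * Suc k \<and> odd j" for j
    by (auto elim!: oddE)
  {
    fix m assume "m \<in> ?L"
    then have mono: "\<And>j. lk m (Suc j) \<le> lk m j" and k: "0 < lk m (2 * k)" "lk m (2 * Suc k) = 0"
      and strict: "\<And>j. 0 < lk m j \<Longrightarrow> lk m (Suc j) < lk m j"
      and ev: "\<And>j. even j \<Longrightarrow> even (lk m j)"
      unfolding G2'_def nth_image_strict_even by auto
    have "int (lk m (Suc j)) + 1
        + (if odd (lk m j) \<noteq> (j < 2 * Suc k \<and> odd j) then if j = 2 * k + 1 then - 1 else 1 else 0)
        + of_bool (odd (lk m (Suc j)) \<noteq> (Suc j < 2 * Suc k \<and> odd (Suc j))) \<le> int (lk m j)"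
      if "j < 2 * Suc k" for j
    proof (cases "j = 2 * k + 1")
      case True
      then show ?thesis using k by (cases "lk m j = 0") auto
    next
      case False
      then have j: "j \<le> 2 * k" using that by simp
      then have "0 < lk m j" using lift_Suc_antimono_le[of "lk m" j "2 * k", OF mono] k by simp
      from strict[OF this] show ?thesis
        using False j ev[of j] ev[of "Suc j"]
        by (cases "even j"; cases "even (lk m j)"; cases "even (lk m (Suc j))"; simp; presburger)
    qed
    then show "m \<in> ?R"
      using antimono_zero_iff[of "lk m", OF mono] k ev
      unfolding parity_gap_set_def I by blast
  next
    fix m assume "m \<in> ?R"
    then have z: "\<forall>j\<ge>2 * Suc k. lk m j = 0"
      and ev: "\<And>j. j < 2 * Suc k \<Longrightarrow> even j \<Longrightarrow> even (lk m j)"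
      and gap: "\<And>j. j < 2 * Suc k \<Longrightarrow> int (lk m (Suc j)) + 1
        + (if odd (lk m j) \<noteq> (j < 2 * Suc k \<and> odd j) then if j = 2 * k + 1 then - 1 else 1 else 0)
        + of_bool (odd (lk m (Suc j)) \<noteq> (Suc j < 2 * Suc k \<and> odd (Suc j))) \<le> int (lk m j)"
      unfolding parity_gap_set_def I by blast+
    have lt: "lk m (Suc j) < lk m j" if "j \<le> 2 * k" for j
      using gap[of j] that by (simp add: of_bool_def split: if_splits)
    have "lk m (Suc j) \<le> lk m j" if "j < 2 * Suc k" for j
      using lt[of j] z that by (cases "j = 2 * k + 1") auto
    with z have mono: "lk m (Suc j) \<le> lk m j" for j
      by (rule antimono_if_eventually_zero)
    have "lk m (Suc j) < lk m j" if "0 < lk m j" for j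
      using lt[of j] z that by (cases "j \<le> 2 * k"; cases "j = 2 * k + 1") auto
    moreover have "even (lk m j)" if "even j" for j
      using ev[of j] z that by (cases "j < 2 * Suc k") auto
    moreover have "0 < lk m (2 * k)" using lt[of "2 * k"] by simp
    ultimately show "m \<in> ?L"
      unfolding G2'_def nth_image_strict_even using z mono by blast
  }
qed

section \<open>Assembling the four identities\<close>

theorem theorem1p6:
  shows "(\<exists>S :: 'a::idom mfps. (part_monom has_sum (1 + S)) G1 \<and>
      fract_has_sum
        (\<lambda>n. (\<Prod>i=1..n. X i ^ 2) * (\<Prod>i=1..n-1. 1 + X (i-1) * X i) * (1 + X (n-1) / X n)
             / (\<Prod>i=1..n. 1 - X i ^ 2)) {1..} S)
    \<and> (\<exists>S :: 'a mfps. (part_monom has_sum (1 + S)) G2 \<and>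
      fract_has_sum
        (\<lambda>n. (\<Prod>i=1..n. X i ^ 2) * (\<Prod>i=1..n. 1 + X (i-1) * X i)
             / (\<Prod>i=1..n. 1 - X i ^ 2)) {1..} S)
    \<and> (\<exists>S :: 'a mfps. (part_monom has_sum (1 + S)) G1' \<and>
      fract_has_sum
        (\<lambda>n. (\<Prod>i=1..2*n-1. X i) * (\<Prod>i=1..n. 1 + X (2*i-2) * X (2*i-1))
             / (\<Prod>i=1..2*n. 1 - X i ^ 2)) {1..} S)
    \<and> (\<exists>S :: 'a mfps. (part_monom has_sum (1 + S)) G2' \<and>
      fract_has_sum
        (\<lambda>n. (\<Prod>i=1..2*n. X i) * (\<Prod>i=1..n-1. 1 + X (2*i-1) * X (2*i)) * (1 + X (2*n-1) / X (2*n))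
             / (\<Prod>i=1..2*n. 1 - X i ^ 2)) {1..} S)"
proof (intro conjI)
  have prod_shift: "(\<Prod>i=Suc 0..n. f i) = (\<Prod>i<n. f (Suc i))" for f :: "nat \<Rightarrow> 'a mfps fract" and n
    using prod.atLeast1_atMost_eq[of f n] by simp
  show "\<exists>S :: 'a mfps. (part_monom has_sum (1 + S)) G1 \<and>
      fract_has_sum
        (\<lambda>n. (\<Prod>i=1..n. X i ^ 2) * (\<Prod>i=1..n-1. 1 + X (i-1) * X i) * (1 + X (n-1) / X n)
             / (\<Prod>i=1..n. 1 - X i ^ 2)) {1..} S"
  proof (rule partition_identity[where t = 1], goal_cases)
    case (4 k)
    \<comment> \<open>Only the factor at \<open>i = k\<close> carries the exponent -1; it becomes
      the quotient X_{n-1} / X_n with n = k + 1.\<close>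
    have "(\<Prod>i<k. 1 + X i * X (Suc i) powi (if i = k then - 1 else 1))
        = (\<Prod>i<k. 1 + X i * X (Suc i) :: 'a mfps fract)"
      by (intro prod.cong) auto
    then show ?case
      unfolding nat_mult_1 G1_class
      by (subst fract_genfun_parity_gap_set) (auto simp: prod_shift power_int_minus divide_inverse mult_ac)
  qed (auto simp: G1_def is_partition_def)
  show "\<exists>S :: 'a mfps. (part_monom has_sum (1 + S)) G2 \<and>
      fract_has_sum
        (\<lambda>n. (\<Prod>i=1..n. X i ^ 2) * (\<Prod>i=1..n. 1 + X (i-1) * X i)
             / (\<Prod>i=1..n. 1 - X i ^ 2)) {1..} S"
  proof (rule partition_identity[where t = 1], goal_cases)
    case (4 k)
    show ?case
      unfolding nat_mult_1 G2_class
      by (subst fract_genfun_parity_gap_set) (auto simp: prod_shift)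
  qed (auto simp: G2_def G1_def is_partition_def)
  show "\<exists>S :: 'a mfps. (part_monom has_sum (1 + S)) G1' \<and>
      fract_has_sum
        (\<lambda>n. (\<Prod>i=1..2*n-1. X i) * (\<Prod>i=1..n. 1 + X (2*i-2) * X (2*i-1))
             / (\<Prod>i=1..2*n. 1 - X i ^ 2)) {1..} S"
  proof (rule partition_identity[where t = 2], goal_cases)
    case (4 k)
    \<comment> \<open>The zero default gap at the end removes X_{2n} from the numerator, where n = k
      + 1.\<close>
    have "(\<Prod>j<2 * Suc k. X (Suc j) powi (if j = 2 * k + 1 then 0 else 1))
        = (\<Prod>j<2 * k + 1. X (Suc j) :: 'a mfps fract)"
      by (simp cong: prod.cong_simp)
    moreover have "(\<Prod>i\<in>(\<lambda>i. 2 * i) ` {..<Suc k}. 1 + X i * X (Suc i))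
        = (\<Prod>i<Suc k. 1 + X (2 * i) * X (Suc (2 * i)) :: 'a mfps fract)"
      by (subst prod.reindex) (auto simp: inj_on_def)
    ultimately show ?case
      unfolding G1'_class
      by (subst fract_genfun_parity_gap_set) (auto simp: prod_shift)
  qed (auto simp: G1'_def strict_partition_def is_partition_def)
  show "\<exists>S :: 'a mfps. (part_monom has_sum (1 + S)) G2' \<and>
      fract_has_sum
        (\<lambda>n. (\<Prod>i=1..2*n. X i) * (\<Prod>i=1..n-1. 1 + X (2*i-1) * X (2*i)) * (1 + X (2*n-1) / X (2*n))
             / (\<Prod>i=1..2*n. 1 - X i ^ 2)) {1..} S"
  proof (rule partition_identity[where t = 2], goal_cases)
    case (4 k)
    have "(\<Prod>i\<in>(\<lambda>i. Suc (2 * i)) ` {..<Suc k}. 1 + X i * X (Suc i) powi (if i = 2 * k + 1 then - 1 else 1))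
        = (\<Prod>i<Suc k. 1 + X (Suc (2 * i)) * X (Suc (Suc (2 * i))) powi (if i = k then - 1 else 1) :: 'a mfps fract)"
      by (subst prod.reindex) (auto simp: inj_on_def)
    \<comment> \<open>The top factor, with exponent -1, is split off as the quotient.\<close>
    also have "\<dots> = (\<Prod>i<k. 1 + X (Suc (2 * i)) * X (Suc (Suc (2 * i)))) * (1 + X (2 * k + 1) / X (2 * k + 2))"
      by (simp add: power_int_minus divide_inverse cong: prod.cong_simp)
    finally show ?case
      unfolding G2'_class
      by (subst fract_genfun_parity_gap_set) (auto simp: prod_shift less_Suc_eq)
  qed (auto simp: G2'_def strict_partition_def is_partition_def)
qed

end
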